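(* There exists a universal constant $C\in(0,\infty)$ such that the following holds. Let $n\in\mathbb{N}$ with $n\ge 1$, let $\mathscr{H}$ be a Hilbert space and let $x_1,\ldots,x_n\in{\bf B}_{\mathscr{H}}$. Then for every $\varepsilon\in(0,1)$ there exist a nonnegative integer $d$ with $$d\leq\frac{C(\log n)^3}{\varepsilon^4}$$ and points $y_1,\ldots,y_n\in\ell_2^d$ such that $$\forall\, i,j\in\{1,\ldots,n\},\qquad \|x_i-x_j\|_{\mathscr{H}}-\varepsilon\leq\|y_i-y_j\|_{\ell_2^d}\leq\|x_i-x_j\|_{\mathscr{H}}+\varepsilon.$$
   Context: ${\bf B}_{\mathscr{H}}=\{x\in\mathscr{H}:\|x\|_{\mathscr{H}}\leq1\}$ is the unit ball of the (real) Hilbert space $\mathscr{H}$. $\ell_2^d$ denotes $\mathbb{R}^d$ with the Euclidean norm, with the convention $\ell_2^0=\{0\}$. $\log$ is the natural logarithm. *)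

theory Defs
  imports "HOL-Analysis.Analysis"
begin

text \<open>
  A point of \<open>l_2^d\<close> is represented by a function \<open>nat \<Rightarrow> real\<close> of which only the coordinates
  \<open>k < d\<close> matter; its norm is \<open>L2_set v {..<d}\<close>, which is \<open>0\<close> for \<open>d = 0\<close>.

  The order of quantifiers ``there is \<open>C\<close> such that for all Hilbert spaces \<open>H\<close>'' cannot be
  written with an existential quantifier when \<open>H\<close> is a type: in \<open>\<exists>C. \<forall>x :: nat \<Rightarrow> 'h. \<dots>\<close>
  the number \<open>C\<close> may depend on \<open>'h\<close>. The constant is therefore named by a closed term without type
  parameters. Which number it denotes is fixed by choice: any \<open>C\<close> that works for all the
  spaces \<open>l_2^m\<close> also works for every Hilbert space, as finitely many points span a
  Euclidean space. So a universal constant exists if and only if this one is universal.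
\<close>

definition universal_C :: real where
  "universal_C = (SOME C. 0 < C \<and>
     (\<forall>(m::nat) (n::nat) (x :: nat \<Rightarrow> nat \<Rightarrow> real).
        1 \<le> n \<longrightarrow> (\<forall>i\<in>{1..n}. L2_set (x i) {..<m} \<le> 1) \<longrightarrow>
        (\<forall>\<epsilon>::real. 0 < \<epsilon> \<longrightarrow> \<epsilon> < 1 \<longrightarrow>
          (\<exists>(d::nat) (y :: nat \<Rightarrow> nat \<Rightarrow> real).
             real d \<le> C * (ln (real n)) ^ 3 / \<epsilon> ^ 4 \<and>
             (\<forall>i\<in>{1..n}. \<forall>j\<in>{1..n}.
                L2_set (\<lambda>k. x i k - x j k) {..<m} - \<epsilon> \<le> L2_set (\<lambda>k. y i k - y j k) {..<d} \<and>
                L2_set (\<lambda>k. y i k - y j k) {..<d} \<le> L2_set (\<lambda>k. x i k - x j k) {..<m} + \<epsilon>)))))"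

end

theory Submission
  imports Defs
begin

text \<open>
  The points lie in a finite-dimensional subspace, so they may be taken in \<open>l_2^m\<close>
  (lemma \<open>finite_set_isometric_to_euclidean\<close>). There, random projection works as in the
  Johnson-Lindenstrauss lemma. For a uniform sign vector \<open>\<sigma>\<close> the square of the inner product
  of \<open>v\<close> with \<open>\<sigma>\<close> has mean \<open>\<bar>v\<bar>\<^sup>2\<close>, and its deviation from the mean is subexponential: for small
  \<open>\<tau>\<close> of either sign, its exponential moment at \<open>\<tau>\<close> is at most \<open>exp (4 \<tau>\<^sup>2 \<bar>v\<bar>\<^sup>4)\<close>
  (lemma \<open>sign_mean_exp_centred_square_le\<close>). Averaging over \<open>d\<close> sign vectors therefore preserves
  each of the \<open>n\<^sup>2\<close> squared distances up to \<open>\<epsilon>\<^sup>2\<close> with a failure probability that is exponentially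
  small in \<open>d \<epsilon>\<^sup>4\<close>, and \<open>d\<close> of order \<open>ln n / \<epsilon>\<^sup>4\<close> makes the union bound succeed. An error of
  \<open>\<epsilon>\<^sup>2\<close> in the squares means an error of at most \<open>\<epsilon>\<close> in the distances, because
  \<open>\<bar>a - b\<bar>\<^sup>2 \<le> \<bar>a\<^sup>2 - b\<^sup>2\<bar>\<close> for nonnegative \<open>a\<close> and \<open>b\<close>. The union bound is carried out by
  choosing the sign vectors one at a time so as to keep a sum of exponentials small (lemma
  \<open>exists_signs_potential_le\<close>); only the mean over a single sign vector is ever used.

  For \<open>n \<ge> 2\<close> the resulting dimension is at most \<open>3080 (ln n)\<^sup>3 / \<epsilon>\<^sup>4\<close>. The number \<open>3080\<close>
  thus witnesses that the choice which defines \<open>universal_C\<close> is made from a nonempty set, and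
  \<open>universal_C\<close> inherits the Euclidean statement, which is then transported to Hilbert space.
\<close>

section \<open>Exponential moments of squared Rademacher sums\<close>

lemma cosh_le_exp_half_square:
  fixes x :: real
  shows "cosh x \<le> exp (x\<^sup>2 / 2)"
proof -
  have fact_bound: "2 ^ n * fact n \<le> (fact (2 * n) :: real)" for n
  proof (induction n)
    case (Suc n)
    have "2 ^ Suc n * fact (Suc n) = (2 * (real n + 1)) * (2 ^ n * fact n :: real)"
      by (simp add: algebra_simps)
    also have "\<dots> \<le> (2 * (real n + 1)) * fact (2 * n)"
      using Suc by (intro mult_left_mono) auto
    also have "\<dots> \<le> (2 * (real n + 1)) * ((2 * real n + 1) * fact (2 * n))"
      by (intro mult_left_mono) auto
    also have "\<dots> = fact (2 * Suc n)"
      by (simp add: algebra_simps)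
    finally show ?case .
  qed simp
  have "(\<lambda>n. if even n then x ^ n /\<^sub>R fact n else 0) sums cosh x"
    by (rule cosh_converges)
  then have cosh: "(\<lambda>n. x ^ (2 * n) /\<^sub>R fact (2 * n)) sums cosh x"
    by (subst (asm) sums_mono_reindex[of "\<lambda>n. 2 * n", symmetric])
       (auto simp: strict_mono_def elim!: evenE)
  have exp: "(\<lambda>n. (x\<^sup>2 / 2) ^ n /\<^sub>R fact n) sums exp (x\<^sup>2 / 2)"
    by (rule exp_converges)
  have "x ^ (2 * n) /\<^sub>R fact (2 * n) \<le> (x\<^sup>2 / 2) ^ n /\<^sub>R fact n" for n
  proof -
    have "x ^ (2 * n) / fact (2 * n) \<le> x ^ (2 * n) / (2 ^ n * fact n)"
      by (intro divide_left_mono fact_bound) auto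
    also have "x ^ (2 * n) / (2 ^ n * fact n) = (x\<^sup>2 / 2) ^ n / fact n"
      by (simp add: power_mult power_divide)
    finally show ?thesis
      by (simp only: real_scaleR_def divide_inverse_commute)
  qed
  then show ?thesis
    by (rule sums_le[OF _ cosh exp])
qed

text \<open>
  Expectation over \<open>m\<close> independent uniform signs. The recursion reveals the last sign, so that
  statements about Rademacher sums follow by induction on \<open>m\<close> without product measures.
\<close>

fun sign_mean :: "nat \<Rightarrow> ((nat \<Rightarrow> real) \<Rightarrow> real) \<Rightarrow> real" where
  "sign_mean 0 F = F (\<lambda>_. 0)"
| "sign_mean (Suc m) F =
     (sign_mean m (\<lambda>\<sigma>. F (\<sigma>(m := 1))) + sign_mean m (\<lambda>\<sigma>. F (\<sigma>(m := -1)))) / 2"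

lemma sign_mean_cmult: "sign_mean m (\<lambda>\<sigma>. c * F \<sigma>) = c * sign_mean m F"
  by (induction m arbitrary: F) (simp_all add: algebra_simps)

lemma sign_mean_add: "sign_mean m (\<lambda>\<sigma>. F \<sigma> + G \<sigma>) = sign_mean m F + sign_mean m G"
  by (induction m arbitrary: F G) (simp_all add: add_divide_distrib)

lemma sign_mean_sum: "sign_mean m (\<lambda>\<sigma>. \<Sum>a\<in>A. F a \<sigma>) = (\<Sum>a\<in>A. sign_mean m (F a))"
proof (induction A rule: infinite_finite_induct)
  have zero: "sign_mean m (\<lambda>\<sigma>. 0) = 0"
    using sign_mean_cmult[of m 0] by simp
  { case (infinite A) then show ?case using zero by simp }
  { case empty show ?case using zero by simp }
qed (simp_all add: sign_mean_add)

lemma exists_le_sign_mean: "\<exists>\<sigma>. F \<sigma> \<le> sign_mean m F"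
proof (induction m arbitrary: F)
  case (Suc m)
  obtain \<sigma> \<sigma>' where
    "F (\<sigma>(m := 1)) \<le> sign_mean m (\<lambda>\<sigma>. F (\<sigma>(m := 1)))"
    "F (\<sigma>'(m := -1)) \<le> sign_mean m (\<lambda>\<sigma>. F (\<sigma>(m := -1)))"
    using Suc[of "\<lambda>\<sigma>. F (\<sigma>(m := 1))"] Suc[of "\<lambda>\<sigma>. F (\<sigma>(m := -1))"] by blast
  then have "F (\<sigma>(m := 1)) \<le> sign_mean (Suc m) F \<or> F (\<sigma>'(m := -1)) \<le> sign_mean (Suc m) F"
    by auto
  then show ?case
    by blast
qed auto

text \<open>
  The shift \<open>a\<close> makes the induction possible: revealing a sign turns \<open>a\<close> into \<open>a \<plusminus> v m\<close>, and
  averaging the two bounds produces a hyperbolic cosine, which is subgaussian. If \<open>\<tau>'\<close> is the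
  coefficient of \<open>a\<^sup>2\<close> reached so far, this raises it by \<open>2 \<tau>'\<^sup>2 (v m)\<^sup>2\<close>. The smallness
  assumption ensures \<open>\<tau>'\<^sup>2 \<le> 2 \<tau>\<^sup>2\<close> throughout, so that the increments add up to at most
  \<open>4 \<tau>\<^sup>2\<close> times the squared length of \<open>v\<close>. A positive \<open>\<tau>\<close> serves the upper tail and a
  negative \<open>\<tau>\<close> the lower tail.
\<close>

lemma sign_mean_exp_shifted_square_le:
  assumes "\<bar>\<tau>\<bar> * (\<Sum>i<m. (v i)\<^sup>2) \<le> 1 / 10"
  shows "sign_mean m (\<lambda>\<sigma>. exp (\<tau> * (a + (\<Sum>i<m. v i * \<sigma> i))\<^sup>2))
    \<le> exp ((a\<^sup>2 + (\<Sum>i<m. (v i)\<^sup>2)) * (\<tau> + 4 * \<tau>\<^sup>2 * (\<Sum>i<m. (v i)\<^sup>2)))"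
  using assms
proof (induction m arbitrary: a)
  case 0
  then show ?case by (simp add: mult.commute)
next
  case (Suc m)
  define S where "S = (\<Sum>i<m. (v i)\<^sup>2)"
  define b where "b = v m"
  define \<tau>' where "\<tau>' = \<tau> + 4 * \<tau>\<^sup>2 * S"
  define T where "T = a\<^sup>2 + S + b\<^sup>2"
  have S: "S \<ge> 0"
    unfolding S_def by (intro sum_nonneg) auto
  have "\<bar>\<tau>\<bar> * (S + b\<^sup>2) \<le> 1 / 10"
    using Suc.prems by (simp add: S_def b_def)
  moreover have "\<bar>\<tau>\<bar> * S \<le> \<bar>\<tau>\<bar> * (S + b\<^sup>2)"
    by (intro mult_left_mono) auto
  ultimately have small: "\<bar>\<tau>\<bar> * S \<le> 1 / 10"
    by linarith
  have IH: "sign_mean m (\<lambda>\<sigma>. exp (\<tau> * (c + (\<Sum>i<m. v i * \<sigma> i))\<^sup>2)) \<le> exp ((c\<^sup>2 + S) * \<tau>')" for c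
    using Suc.IH[of c] small by (simp add: S_def \<tau>'_def)
  have reveal: "a + (\<Sum>i<Suc m. v i * (\<sigma>(m := s)) i) = (a + b * s) + (\<Sum>i<m. v i * \<sigma> i)" for \<sigma> s
  proof -
    have "(\<Sum>i<m. v i * (\<sigma>(m := s)) i) = (\<Sum>i<m. v i * \<sigma> i)"
      by (intro sum.cong) auto
    then show ?thesis by (simp add: b_def)
  qed
  have "sign_mean (Suc m) (\<lambda>\<sigma>. exp (\<tau> * (a + (\<Sum>i<Suc m. v i * \<sigma> i))\<^sup>2))
      \<le> (exp (((a + b)\<^sup>2 + S) * \<tau>') + exp (((a - b)\<^sup>2 + S) * \<tau>')) / 2"
    using IH[of "a + b"] IH[of "a - b"] unfolding sign_mean.simps reveal by simp
  also have "\<dots> = exp (T * \<tau>') * cosh (2 * \<tau>' * a * b)"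
    by (simp add: cosh_def T_def field_simps power2_eq_square flip: exp_add)
  also have "\<dots> \<le> exp (T * \<tau>') * exp ((2 * \<tau>' * a * b)\<^sup>2 / 2)"
    by (intro mult_left_mono cosh_le_exp_half_square) auto
  also have "\<dots> = exp (T * \<tau>' + a\<^sup>2 * (2 * \<tau>'\<^sup>2 * b\<^sup>2))"
    by (simp add: power_mult_distrib flip: exp_add)
  also have "\<dots> \<le> exp (T * (\<tau> + 4 * \<tau>\<^sup>2 * (S + b\<^sup>2)))"
  proof -
    have "\<tau>' = \<tau> * (1 + 4 * (\<tau> * S))"
      by (simp add: \<tau>'_def power2_eq_square algebra_simps)
    moreover have "\<bar>\<tau> * S\<bar> \<le> 1 / 10"
      using small S by (simp add: abs_mult)
    then have "\<bar>1 + 4 * (\<tau> * S)\<bar> \<le> 7 / 5"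
      by linarith
    then have "(1 + 4 * (\<tau> * S))\<^sup>2 \<le> (7 / 5)\<^sup>2"
      by (metis abs_ge_zero power2_abs power_mono)
    then have "(1 + 4 * (\<tau> * S))\<^sup>2 \<le> 2"
      by (simp add: power2_eq_square)
    ultimately have \<tau>': "\<tau>'\<^sup>2 \<le> \<tau>\<^sup>2 * 2"
      by (simp add: power_mult_distrib mult_left_mono)
    have "a\<^sup>2 * (2 * \<tau>'\<^sup>2 * b\<^sup>2) \<le> T * (2 * (\<tau>\<^sup>2 * 2) * b\<^sup>2)"
      using S \<tau>' by (intro mult_mono) (auto simp: T_def)
    then show ?thesis
      by (simp add: \<tau>'_def algebra_simps)
  qed
  finally show ?case
    by (simp add: T_def S_def b_def add.assoc)
qed

corollary sign_mean_exp_centred_square_le: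
  assumes "\<bar>\<tau>\<bar> * (\<Sum>i<m. (v i)\<^sup>2) \<le> 1 / 10"
  shows "sign_mean m (\<lambda>\<sigma>. exp (\<tau> * ((\<Sum>i<m. v i * \<sigma> i)\<^sup>2 - (\<Sum>i<m. (v i)\<^sup>2))))
    \<le> exp (4 * \<tau>\<^sup>2 * (\<Sum>i<m. (v i)\<^sup>2)\<^sup>2)"
proof -
  define S where "S = (\<Sum>i<m. (v i)\<^sup>2)"
  have "sign_mean m (\<lambda>\<sigma>. exp (\<tau> * ((\<Sum>i<m. v i * \<sigma> i)\<^sup>2 - S)))
      = exp (- \<tau> * S) * sign_mean m (\<lambda>\<sigma>. exp (\<tau> * (0 + (\<Sum>i<m. v i * \<sigma> i))\<^sup>2))"
    by (simp add: algebra_simps flip: sign_mean_cmult exp_add)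
  also have "\<dots> \<le> exp (- \<tau> * S) * exp ((0\<^sup>2 + S) * (\<tau> + 4 * \<tau>\<^sup>2 * S))"
    using sign_mean_exp_shifted_square_le[OF assms, of 0]
    by (intro mult_left_mono) (simp_all add: S_def)
  also have "\<dots> = exp (4 * \<tau>\<^sup>2 * S\<^sup>2)"
    by (simp add: power2_eq_square algebra_simps flip: exp_add)
  finally show ?thesis
    by (simp add: S_def)
qed

section \<open>Choosing sign vectors\<close>

text \<open>
  Method of conditional expectations: the sign vectors are chosen one after another, each so that
  the potential \<open>\<Sum>a. exp (\<Sum>k. G a (\<sigma> k))\<close> grows by no more than its mean growth.
\<close>

lemma exists_signs_potential_le:
  assumes "\<And>a. a \<in> A \<Longrightarrow> sign_mean m (\<lambda>\<sigma>. exp (G a \<sigma>)) \<le> exp c"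
  shows "\<exists>\<sigma>. (\<Sum>a\<in>A. exp (\<Sum>k<d. G a (\<sigma> k))) \<le> real (card A) * exp (real d * c)"
proof (induction d)
  case (Suc d)
  then obtain \<sigma> where \<sigma>: "(\<Sum>a\<in>A. exp (\<Sum>k<d. G a (\<sigma> k))) \<le> real (card A) * exp (real d * c)"
    by blast
  define w where "w a = exp (\<Sum>k<d. G a (\<sigma> k))" for a
  obtain \<rho> where \<rho>: "(\<Sum>a\<in>A. w a * exp (G a \<rho>)) \<le> sign_mean m (\<lambda>\<rho>. \<Sum>a\<in>A. w a * exp (G a \<rho>))"
    using exists_le_sign_mean[of "\<lambda>\<rho>. \<Sum>a\<in>A. w a * exp (G a \<rho>)" m] by blast
  have "(\<Sum>a\<in>A. exp (\<Sum>k<Suc d. G a ((\<sigma>(d := \<rho>)) k))) = (\<Sum>a\<in>A. w a * exp (G a \<rho>))"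
    by (intro sum.cong) (auto simp: w_def exp_add)
  also note \<rho>
  also have "sign_mean m (\<lambda>\<rho>. \<Sum>a\<in>A. w a * exp (G a \<rho>))
      = (\<Sum>a\<in>A. w a * sign_mean m (\<lambda>\<rho>. exp (G a \<rho>)))"
    by (simp add: sign_mean_sum sign_mean_cmult)
  also have "\<dots> \<le> (\<Sum>a\<in>A. w a * exp c)"
    using assms by (intro sum_mono mult_left_mono) (auto simp: w_def)
  also have "\<dots> \<le> real (card A) * exp (real d * c) * exp c"
    using \<sigma> by (simp add: w_def flip: sum_distrib_right)
  finally have "(\<Sum>a\<in>A. exp (\<Sum>k<Suc d. G a ((\<sigma>(d := \<rho>)) k)))
      \<le> real (card A) * exp (real (Suc d) * c)"
    by (simp add: algebra_simps exp_add)
  then show ?case by blast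
qed simp

text \<open>
  The bound on the potential controls every single exponent, and including both signs of \<open>\<tau>\<close> in
  the index set controls both tails at once.
\<close>

lemma exists_signs_squared_norms_close:
  fixes v :: "'p \<Rightarrow> nat \<Rightarrow> real"
  assumes "finite P"
    and S: "\<And>p. p \<in> P \<Longrightarrow> (\<Sum>i<m. (v p i)\<^sup>2) \<le> 4"
    and \<tau>: "0 < \<tau>" "\<tau> \<le> 1 / 40"
  shows "\<exists>\<sigma> :: nat \<Rightarrow> nat \<Rightarrow> real. \<forall>p\<in>P.
    \<tau> * \<bar>(\<Sum>k<d. (\<Sum>i<m. v p i * \<sigma> k i)\<^sup>2) - real d * (\<Sum>i<m. (v p i)\<^sup>2)\<bar>
      \<le> ln (2 * real (card P)) + 64 * real d * \<tau>\<^sup>2"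
proof -
  define A where "A = P \<times> {1, -1 :: real}"
  define D where "D p \<sigma> = (\<Sum>i<m. v p i * \<sigma> i)\<^sup>2 - (\<Sum>i<m. (v p i)\<^sup>2)" for p \<sigma>
  define G where "G = (\<lambda>(p, s) \<sigma>. s * \<tau> * D p \<sigma>)"
  have A: "finite A" "card A = 2 * card P"
    using assms(1) by (simp_all add: A_def card_cartesian_product)
  have "sign_mean m (\<lambda>\<sigma>. exp (G a \<sigma>)) \<le> exp (64 * \<tau>\<^sup>2)" if "a \<in> A" for a
  proof -
    obtain p s where a: "a = (p, s)" "p \<in> P" and "s \<in> {1, -1}"
      using \<open>a \<in> A\<close> unfolding A_def by blast
    then have s: "\<bar>s\<bar> = 1"
      by auto
    have nonneg: "0 \<le> (\<Sum>i<m. (v p i)\<^sup>2)"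
      by (intro sum_nonneg) auto
    have "\<bar>s * \<tau>\<bar> * (\<Sum>i<m. (v p i)\<^sup>2) \<le> 1 / 40 * 4"
      using \<tau> S[OF a(2)] nonneg s by (intro mult_mono) (auto simp: abs_mult)
    then have "sign_mean m (\<lambda>\<sigma>. exp (s * \<tau> * D p \<sigma>))
        \<le> exp (4 * (s * \<tau>)\<^sup>2 * (\<Sum>i<m. (v p i)\<^sup>2)\<^sup>2)"
      unfolding D_def by (intro sign_mean_exp_centred_square_le) simp
    also have "(s * \<tau>)\<^sup>2 = \<tau>\<^sup>2"
      using s by (metis abs_1 abs_mult mult_1 power2_abs)
    also have "exp (4 * \<tau>\<^sup>2 * (\<Sum>i<m. (v p i)\<^sup>2)\<^sup>2) \<le> exp (4 * \<tau>\<^sup>2 * 4\<^sup>2)"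
      using S[OF a(2)] nonneg by (subst exp_le_cancel_iff, intro mult_left_mono power_mono) auto
    finally show ?thesis
      by (simp add: G_def a)
  qed
  then obtain \<sigma> where pot:
    "(\<Sum>a\<in>A. exp (\<Sum>k<d. G a (\<sigma> k))) \<le> real (card A) * exp (real d * (64 * \<tau>\<^sup>2))"
    using exists_signs_potential_le[of A m G "64 * \<tau>\<^sup>2" d] by blast
  have each: "(\<Sum>k<d. G a (\<sigma> k)) \<le> ln (2 * real (card P)) + 64 * real d * \<tau>\<^sup>2" if "a \<in> A" for a
  proof -
    have "exp (\<Sum>k<d. G a (\<sigma> k)) \<le> (\<Sum>a\<in>A. exp (\<Sum>k<d. G a (\<sigma> k)))"
      using A(1) that by (intro member_le_sum) auto
    also note pot
    also have "real (card A) * exp (real d * (64 * \<tau>\<^sup>2))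
        = exp (ln (2 * real (card P)) + 64 * real d * \<tau>\<^sup>2)"
    proof -
      have "P \<noteq> {}"
        using that by (auto simp: A_def)
      then have "0 < card P"
        using assms(1) by (simp add: card_gt_0_iff)
      then show ?thesis
        using A by (simp add: exp_add mult_ac)
    qed
    finally show ?thesis by simp
  qed
  have "\<tau> * \<bar>(\<Sum>k<d. (\<Sum>i<m. v p i * \<sigma> k i)\<^sup>2) - real d * (\<Sum>i<m. (v p i)\<^sup>2)\<bar>
      \<le> ln (2 * real (card P)) + 64 * real d * \<tau>\<^sup>2" if "p \<in> P" for p
  proof -
    have G: "(\<Sum>k<d. G (p, s) (\<sigma> k))
        = s * (\<tau> * ((\<Sum>k<d. (\<Sum>i<m. v p i * \<sigma> k i)\<^sup>2) - real d * (\<Sum>i<m. (v p i)\<^sup>2)))" for s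
      by (simp add: G_def D_def sum_subtractf flip: sum_distrib_left)
    have "\<bar>\<tau> * ((\<Sum>k<d. (\<Sum>i<m. v p i * \<sigma> k i)\<^sup>2) - real d * (\<Sum>i<m. (v p i)\<^sup>2))\<bar>
        \<le> ln (2 * real (card P)) + 64 * real d * \<tau>\<^sup>2"
      using each[of "(p, 1)"] each[of "(p, -1)"] that
      unfolding G by (simp add: A_def abs_le_iff)
    then show ?thesis
      using \<tau>(1) by (simp add: abs_mult)
  qed
  then show ?thesis by blast
qed

section \<open>Dimension reduction with an additive error\<close>

lemma abs_diff_square_le_abs_diff_squares:
  fixes a b :: real
  assumes "0 \<le> a" "0 \<le> b"
  shows "\<bar>a - b\<bar>\<^sup>2 \<le> \<bar>a\<^sup>2 - b\<^sup>2\<bar>"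
proof -
  have "\<bar>a - b\<bar> * \<bar>a - b\<bar> \<le> \<bar>a - b\<bar> * \<bar>a + b\<bar>"
    using assms by (intro mult_left_mono) auto
  then show ?thesis
    by (simp add: power2_eq_square square_diff_square_factored mult.commute flip: abs_mult)
qed

lemma L2_set_power2: "(L2_set f A)\<^sup>2 = (\<Sum>i\<in>A. (f i)\<^sup>2)"
  by (simp add: L2_set_def sum_nonneg)

text \<open>
  The points are mapped to their normalised inner products with the chosen sign vectors. This map
  is linear, so its effect on differences is governed by the vectors \<open>x i - x j\<close>, of length at
  most two. Squared distances are preserved up to \<open>\<epsilon>\<^sup>2\<close>, hence distances up to \<open>\<epsilon>\<close>.
\<close>

lemma euclidean_dimension_reduction:
  fixes x :: "nat \<Rightarrow> nat \<Rightarrow> real"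
  assumes n: "2 \<le> n" and x: "\<And>i. i \<in> {1..n} \<Longrightarrow> L2_set (x i) {..<m} \<le> 1"
    and \<epsilon>: "0 < \<epsilon>" "\<epsilon> < 1"
    and d: "768 * ln (real n) / \<epsilon> ^ 4 \<le> real d"
  shows "\<exists>y :: nat \<Rightarrow> nat \<Rightarrow> real. \<forall>i\<in>{1..n}. \<forall>j\<in>{1..n}.
    \<bar>L2_set (\<lambda>k. y i k - y j k) {..<d} - L2_set (\<lambda>k. x i k - x j k) {..<m}\<bar> \<le> \<epsilon>"
proof -
  define P where "P = {1..n} \<times> {1..n}"
  define v where "v = (\<lambda>(i, j) k. x i k - x j k)"
  \<comment> \<open>This value makes the quadratic error term \<open>64 \<tau>\<close> equal to \<open>\<epsilon>\<^sup>2 / 2\<close>.\<close>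
  define \<tau> where "\<tau> = \<epsilon>\<^sup>2 / 128"
  have "\<epsilon>\<^sup>2 \<le> 1"
    using \<epsilon> by (simp add: power_le_one)
  then have \<tau>: "0 < \<tau>" "\<tau> \<le> 1 / 40"
    using \<epsilon> by (auto simp: \<tau>_def)
  have ln_n: "0 < ln (real n)"
    using n by simp
  then have d_pos: "0 < real d"
    using d \<epsilon> by (smt (verit) divide_pos_pos zero_less_power)
  have "(\<Sum>k<m. (v p k)\<^sup>2) \<le> 4" if p: "p \<in> P" for p
  proof -
    obtain i j where ij: "p = (i, j)" "i \<in> {1..n}" "j \<in> {1..n}"
      using p by (auto simp: P_def)
    have "L2_set (v p) {..<m} = L2_set (\<lambda>k. x i k + - x j k) {..<m}"
      by (simp add: v_def ij)
    also have "\<dots> \<le> L2_set (x i) {..<m} + L2_set (\<lambda>k. - x j k) {..<m}"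
      by (rule L2_set_triangle_ineq)
    also have "L2_set (\<lambda>k. - x j k) {..<m} = L2_set (x j) {..<m}"
      by (simp add: L2_set_def)
    finally have "L2_set (v p) {..<m} \<le> 2"
      using x[OF ij(2)] x[OF ij(3)] by linarith
    then have "(L2_set (v p) {..<m})\<^sup>2 \<le> 2\<^sup>2"
      by (intro power_mono) auto
    then show ?thesis
      by (simp add: L2_set_power2)
  qed
  moreover have "finite P"
    by (simp add: P_def)
  ultimately obtain \<sigma> where \<sigma>: "\<And>p. p \<in> P \<Longrightarrow>
      \<tau> * \<bar>(\<Sum>k<d. (\<Sum>i<m. v p i * \<sigma> k i)\<^sup>2) - real d * (\<Sum>i<m. (v p i)\<^sup>2)\<bar>
        \<le> ln (2 * real (card P)) + 64 * real d * \<tau>\<^sup>2"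
    using exists_signs_squared_norms_close[of P v m \<tau> d] \<tau> by blast
  have "ln (2 * real (card P)) \<le> ln (real n ^ 3)"
    using n by (intro ln_mono) (auto simp: P_def power3_eq_cube)
  also have "\<dots> = 3 * ln (real n)"
    using n by (simp add: ln_realpow)
  also have "\<dots> \<le> \<tau> * real d * (\<epsilon>\<^sup>2 / 2)"
    using d \<epsilon> by (simp add: \<tau>_def field_simps power4_eq_xxxx power2_eq_square)
  finally have main: "ln (2 * real (card P)) + 64 * real d * \<tau>\<^sup>2 \<le> \<tau> * (real d * \<epsilon>\<^sup>2)"
    by (simp add: \<tau>_def field_simps power2_eq_square)
  define y where "y i k = (\<Sum>l<m. x i l * \<sigma> k l) / sqrt (real d)" for i k
  have "\<bar>L2_set (\<lambda>k. y i k - y j k) {..<d} - L2_set (\<lambda>k. x i k - x j k) {..<m}\<bar> \<le> \<epsilon>"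
    if ij: "i \<in> {1..n}" "j \<in> {1..n}" for i j
  proof -
    define Y where "Y = L2_set (\<lambda>k. y i k - y j k) {..<d}"
    define X where "X = L2_set (\<lambda>k. x i k - x j k) {..<m}"
    have diff: "y i k - y j k = (\<Sum>l<m. v (i, j) l * \<sigma> k l) / sqrt (real d)" for k
      by (simp add: y_def v_def left_diff_distrib sum_subtractf diff_divide_distrib)
    have "Y\<^sup>2 = (\<Sum>k<d. (\<Sum>l<m. v (i, j) l * \<sigma> k l)\<^sup>2) / real d"
      unfolding Y_def L2_set_power2 diff by (simp add: power_divide flip: sum_divide_distrib)
    then have Y: "(\<Sum>k<d. (\<Sum>l<m. v (i, j) l * \<sigma> k l)\<^sup>2) = real d * Y\<^sup>2"
      using d_pos by simp
    have X: "(\<Sum>l<m. (v (i, j) l)\<^sup>2) = X\<^sup>2"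
      by (simp add: X_def L2_set_power2 v_def)
    have "\<tau> * \<bar>real d * Y\<^sup>2 - real d * X\<^sup>2\<bar> \<le> \<tau> * (real d * \<epsilon>\<^sup>2)"
      using \<sigma>[of "(i, j)"] ij main by (simp add: P_def X Y)
    then have "\<bar>real d * (Y\<^sup>2 - X\<^sup>2)\<bar> \<le> real d * \<epsilon>\<^sup>2"
      using \<tau>(1) by (simp add: right_diff_distrib)
    then have "\<bar>Y\<^sup>2 - X\<^sup>2\<bar> \<le> \<epsilon>\<^sup>2"
      using d_pos by (simp add: abs_mult)
    moreover have "\<bar>Y - X\<bar>\<^sup>2 \<le> \<bar>Y\<^sup>2 - X\<^sup>2\<bar>"
      by (intro abs_diff_square_le_abs_diff_squares) (simp_all add: X_def Y_def)
    ultimately have "\<bar>Y - X\<bar>\<^sup>2 \<le> \<epsilon>\<^sup>2"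
      by linarith
    then have "\<bar>Y - X\<bar> \<le> \<epsilon>"
      using \<epsilon> by (auto intro: power2_le_imp_le)
    then show ?thesis
      by (simp add: X_def Y_def)
  qed
  then show ?thesis by blast
qed

text \<open>
  For \<open>n = 1\<close> the bound forces \<open>d = 0\<close>, which suffices for a single point. For \<open>n \<ge> 2\<close> the
  logarithm is at least \<open>1 / 2\<close>, so \<open>(ln n) ^ 3\<close> dominates both \<open>ln n\<close> and the error of rounding
  the dimension up to an integer.
\<close>

lemma euclidean_dimension_reduction_bound:
  fixes x :: "nat \<Rightarrow> nat \<Rightarrow> real"
  assumes n: "1 \<le> n" and x: "\<forall>i\<in>{1..n}. L2_set (x i) {..<m} \<le> 1"
    and \<epsilon>: "0 < \<epsilon>" "\<epsilon> < 1"
  shows "\<exists>(d::nat) (y :: nat \<Rightarrow> nat \<Rightarrow> real).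
    real d \<le> 3080 * (ln (real n)) ^ 3 / \<epsilon> ^ 4 \<and>
    (\<forall>i\<in>{1..n}. \<forall>j\<in>{1..n}.
      L2_set (\<lambda>k. x i k - x j k) {..<m} - \<epsilon> \<le> L2_set (\<lambda>k. y i k - y j k) {..<d} \<and>
      L2_set (\<lambda>k. y i k - y j k) {..<d} \<le> L2_set (\<lambda>k. x i k - x j k) {..<m} + \<epsilon>)"
proof (cases "n = 1")
  case True
  then show ?thesis
    using \<epsilon> by (intro exI[of _ 0] exI[of _ "\<lambda>_ _. 0"]) (auto simp: L2_set_def)
next
  case False
  then have n2: "2 \<le> n"
    using n by simp
  define L where "L = ln (real n)"
  have "1 / 2 \<le> ln (2 :: real)"
    using ln_ge_iff[of "2::real" "1/2"] exp_bound_half[of "1/2::real"] by simp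
  also have "\<dots> \<le> L"
    using n2 by (simp add: L_def)
  finally have L: "1 / 2 \<le> L" .
  define d where "d = nat \<lceil>768 * L / \<epsilon> ^ 4\<rceil>"
  have \<epsilon>4: "0 < \<epsilon> ^ 4" "\<epsilon> ^ 4 \<le> 1"
    using \<epsilon> by (auto simp: power_le_one)
  have "0 \<le> 768 * L / \<epsilon> ^ 4"
    using L \<epsilon>4 by simp
  then have d: "768 * L / \<epsilon> ^ 4 \<le> real d" "real d \<le> 768 * L / \<epsilon> ^ 4 + 1"
    unfolding d_def by linarith+
  obtain y :: "nat \<Rightarrow> nat \<Rightarrow> real" where y: "\<forall>i\<in>{1..n}. \<forall>j\<in>{1..n}.
      \<bar>L2_set (\<lambda>k. y i k - y j k) {..<d} - L2_set (\<lambda>k. x i k - x j k) {..<m}\<bar> \<le> \<epsilon>"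
    using euclidean_dimension_reduction[of n x m \<epsilon> d] n2 x \<epsilon> d(1) by (auto simp: L_def)
  have "(1 / 2)\<^sup>2 \<le> L\<^sup>2"
    using L by (intro power_mono) auto
  then have "(1 / 2)\<^sup>2 * L \<le> L\<^sup>2 * L"
    using L by (intro mult_right_mono) auto
  then have "L \<le> 4 * L ^ 3"
    by (simp add: power2_eq_square power3_eq_cube)
  then have "768 * L + 1 \<le> 3080 * L ^ 3"
    using L by linarith
  then have "768 * L + \<epsilon> ^ 4 \<le> 3080 * L ^ 3"
    using \<epsilon>4 by linarith
  then have "(768 * L + \<epsilon> ^ 4) / \<epsilon> ^ 4 \<le> 3080 * L ^ 3 / \<epsilon> ^ 4"
    using \<epsilon>4 by (intro divide_right_mono) auto
  then have "768 * L / \<epsilon> ^ 4 + 1 \<le> 3080 * L ^ 3 / \<epsilon> ^ 4"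
    using \<epsilon>4 by (simp add: add_divide_distrib)
  then have "real d \<le> 3080 * L ^ 3 / \<epsilon> ^ 4"
    using d(2) by linarith
  moreover have "\<forall>i\<in>{1..n}. \<forall>j\<in>{1..n}.
      L2_set (\<lambda>k. x i k - x j k) {..<m} - \<epsilon> \<le> L2_set (\<lambda>k. y i k - y j k) {..<d} \<and>
      L2_set (\<lambda>k. y i k - y j k) {..<d} \<le> L2_set (\<lambda>k. x i k - x j k) {..<m} + \<epsilon>"
    using y by (force simp: abs_le_iff)
  ultimately show ?thesis
    unfolding L_def by blast
qed

section \<open>Reduction of Hilbert space to Euclidean space\<close>

text \<open>
  This is Parseval's identity for the normalised members of \<open>C\<close>. A vanishing member of \<open>C\<close> contributes \<open>0\<close> on the right, as division by zero
  gives zero.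
\<close>

lemma norm_power2_orthogonal_expansion:
  fixes w :: "'h::real_inner"
  assumes "finite C" "pairwise orthogonal C" "w \<in> span C"
  shows "(norm w)\<^sup>2 = (\<Sum>c\<in>C. (inner w c / norm c)\<^sup>2)"
proof -
  obtain u where w: "w = (\<Sum>c\<in>C. u c *\<^sub>R c)"
    using assms(1,3) by (auto simp: span_finite)
  have "inner w c = u c * (norm c)\<^sup>2" if c: "c \<in> C" for c
  proof -
    have "inner w c = (\<Sum>b\<in>C. u b * inner b c)"
      by (simp add: w inner_sum_left)
    also have "\<dots> = (\<Sum>b\<in>C. if b = c then u c * inner c c else 0)"
      using assms(2) c by (intro sum.cong) (auto simp: pairwise_def orthogonal_def)
    also have "\<dots> = u c * inner c c"
      using assms(1) c by simp
    finally show ?thesis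
      by (simp add: dot_square_norm)
  qed
  then have "(\<Sum>c\<in>C. (inner w c / norm c)\<^sup>2) = (\<Sum>c\<in>C. (norm (u c *\<^sub>R c))\<^sup>2)"
    by (intro sum.cong) (auto simp: power2_eq_square)
  also have "\<dots> = (norm w)\<^sup>2"
    unfolding w using assms(1,2)
    by (subst norm_sum_Pythagorean) (auto simp: pairwise_def orthogonal_def)
  finally show ?thesis by simp
qed

lemma finite_set_isometric_to_euclidean:
  fixes V :: "'h::real_inner set"
  assumes "finite V"
  shows "\<exists>(m::nat) (f :: 'h \<Rightarrow> nat \<Rightarrow> real).
    (\<forall>u\<in>V. L2_set (f u) {..<m} = norm u) \<and>
    (\<forall>u\<in>V. \<forall>v\<in>V. L2_set (\<lambda>k. f u k - f v k) {..<m} = norm (u - v))"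
proof -
  obtain C where C: "finite C" "span C = span V" "pairwise orthogonal C"
    using basis_orthogonal[OF assms] by blast
  obtain e where e: "bij_betw e {..<card C} C"
    using C(1) ex_bij_betw_nat_finite by (auto simp: lessThan_atLeast0)
  define f where "f u k = inner u (e k) / norm (e k)" for u :: 'h and k
  have norm_f: "L2_set (f w) {..<card C} = norm w" if "w \<in> span C" for w
  proof -
    have "(\<Sum>k<card C. (f w k)\<^sup>2) = (\<Sum>c\<in>C. (inner w c / norm c)\<^sup>2)"
      unfolding f_def by (rule sum.reindex_bij_betw[OF e])
    also have "\<dots> = (norm w)\<^sup>2"
      using norm_power2_orthogonal_expansion[OF C(1,3) that] by simp
    finally show ?thesis
      by (simp add: L2_set_def)
  qed
  have V: "u \<in> span C" if "u \<in> V" for u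
    using that C(2) by (simp add: span_base)
  have "(\<lambda>k. f u k - f v k) = f (u - v)" for u v
    by (simp add: f_def fun_eq_iff inner_diff_left diff_divide_distrib)
  moreover have "u - v \<in> span C" if "u \<in> V" "v \<in> V" for u v
    using that V by (simp add: span_diff)
  ultimately show ?thesis
    using norm_f V by (intro exI[of _ "card C"] exI[of _ f]) simp
qed

lemma universal_C_Euclidean:
  "0 < universal_C \<and>
   (\<forall>(m::nat) (n::nat) (x :: nat \<Rightarrow> nat \<Rightarrow> real).
      1 \<le> n \<longrightarrow> (\<forall>i\<in>{1..n}. L2_set (x i) {..<m} \<le> 1) \<longrightarrow>
      (\<forall>\<epsilon>::real. 0 < \<epsilon> \<longrightarrow> \<epsilon> < 1 \<longrightarrow>
        (\<exists>(d::nat) (y :: nat \<Rightarrow> nat \<Rightarrow> real).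
           real d \<le> universal_C * (ln (real n)) ^ 3 / \<epsilon> ^ 4 \<and>
           (\<forall>i\<in>{1..n}. \<forall>j\<in>{1..n}.
              L2_set (\<lambda>k. x i k - x j k) {..<m} - \<epsilon> \<le> L2_set (\<lambda>k. y i k - y j k) {..<d} \<and>
              L2_set (\<lambda>k. y i k - y j k) {..<d} \<le> L2_set (\<lambda>k. x i k - x j k) {..<m} + \<epsilon>))))"
  unfolding universal_C_def
  by (rule someI[where x = 3080]) (use euclidean_dimension_reduction_bound in auto)

theorem corollary9:
  "0 < universal_C \<and>
   (\<forall>(n::nat) (x :: nat \<Rightarrow> 'h::{real_inner, banach}).
      1 \<le> n \<longrightarrow> (\<forall>i\<in>{1..n}. norm (x i) \<le> 1) \<longrightarrow>
      (\<forall>\<epsilon>::real. 0 < \<epsilon> \<longrightarrow> \<epsilon> < 1 \<longrightarrow>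
        (\<exists>(d::nat) (y :: nat \<Rightarrow> nat \<Rightarrow> real).
           real d \<le> universal_C * (ln (real n)) ^ 3 / \<epsilon> ^ 4 \<and>
           (\<forall>i\<in>{1..n}. \<forall>j\<in>{1..n}.
              norm (x i - x j) - \<epsilon> \<le> L2_set (\<lambda>k. y i k - y j k) {..<d} \<and>
              L2_set (\<lambda>k. y i k - y j k) {..<d} \<le> norm (x i - x j) + \<epsilon>))))"
proof (intro conjI allI impI)
  show "0 < universal_C"
    using universal_C_Euclidean by blast
next
  fix n :: nat and x :: "nat \<Rightarrow> 'h" and \<epsilon> :: real
  assume n: "1 \<le> n" and x: "\<forall>i\<in>{1..n}. norm (x i) \<le> 1" and \<epsilon>: "0 < \<epsilon>" "\<epsilon> < 1"
  obtain m and f :: "'h \<Rightarrow> nat \<Rightarrow> real" where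
    norm: "\<forall>u\<in>x ` {1..n}. L2_set (f u) {..<m} = norm u" and
    dist: "\<forall>u\<in>x ` {1..n}. \<forall>v\<in>x ` {1..n}. L2_set (\<lambda>k. f u k - f v k) {..<m} = norm (u - v)"
    using finite_set_isometric_to_euclidean[of "x ` {1..n}"] by auto
  have "\<forall>i\<in>{1..n}. L2_set (f (x i)) {..<m} \<le> 1"
    using norm x by simp
  then obtain d y where d: "real d \<le> universal_C * (ln (real n)) ^ 3 / \<epsilon> ^ 4"
    and y: "\<forall>i\<in>{1..n}. \<forall>j\<in>{1..n}.
      L2_set (\<lambda>k. f (x i) k - f (x j) k) {..<m} - \<epsilon> \<le> L2_set (\<lambda>k. y i k - y j k) {..<d} \<and>
      L2_set (\<lambda>k. y i k - y j k) {..<d} \<le> L2_set (\<lambda>k. f (x i) k - f (x j) k) {..<m} + \<epsilon>"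
    using universal_C_Euclidean[THEN conjunct2, rule_format, of n "\<lambda>i. f (x i)" m \<epsilon>] n \<epsilon> by blast
  show "\<exists>(d::nat) (y :: nat \<Rightarrow> nat \<Rightarrow> real).
      real d \<le> universal_C * (ln (real n)) ^ 3 / \<epsilon> ^ 4 \<and>
      (\<forall>i\<in>{1..n}. \<forall>j\<in>{1..n}.
         norm (x i - x j) - \<epsilon> \<le> L2_set (\<lambda>k. y i k - y j k) {..<d} \<and>
         L2_set (\<lambda>k. y i k - y j k) {..<d} \<le> norm (x i - x j) + \<epsilon>)"
    using d y dist by (intro exI[of _ d] exI[of _ y]) auto
qed

end
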